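(* Let $n\ge 2$. Let $t$ be the term $h^{[b_1,a_1]}\cdots h^{[b_k,a_k]}$ with $k\ge 1$, $1\le a_m\le b_m\le n-1$ for each $m$, $a_1<\dots<a_k$ and $b_1<\dots<b_k$. Then the sequence $T_{\delta(t)}$ is $a_1,\dots,a_k$ and the sequence $B_{\delta(t)}$ is $b_1,\dots,b_k$.
   Context: Terms. Let $n\ge 2$. Terms are built inductively from the generators $h^1,\dots,h^{n-1}$ and $c$ and the constant $\mathbf 1$ by the binary operation $(t,u)\mapsto(tu)$ (superscripts on $h$ are indices, not powers). For $1\le j\le i\le n-1$ the block $h^{[i,j]}$ is $h^ih^{i-1}\cdots h^{j+1}h^j$ (so $h^{[i,i]}=h^i$). Products are taken with parentheses associated to the left. $n$-diagrams. For real $a>0$ let $R_{n,a}=[0,n+1]\times[0,a]$, with top $[0,n+1]\times\{a\}$ and bottom $[0,n+1]\times\{0\}$. An $n$-diagram $D$ in $R_{n,a}$ is a compact one-manifold with boundary, with finitely many connected components, embedded in $R_{n,a}$, such that its intersection with the top is $t(D)=\{(i,a): i=1,\dots,n\}$, its intersection with the bottom is $b(D)=\{(i,0): i=1,\dots,n\}$, and $t(D)\cup b(D)$ is its set of boundary points. Its components homeomorphic to $[0,1]$ are called threads; its components homeomorphic to $S^1$ are called circular components. A thread is transversal if it has one end point in $t(D)$ and one in $b(D)$; otherwise it is a cup if both end points are in $t(D)$, and a cap if both are in $b(D)$. Composition. For $D_1$ in $R_{n,a}$ and $D_2$ in $R_{n,b}$, $D_2\circ D_1=\{(x,y+b):(x,y)\in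 D_1\}\cup D_2$, an $n$-diagram in $R_{n,a+b}$ ($D_1$ is placed above $D_2$). Particular diagrams. The unit $n$-diagram is $I=\{(i,y): i\in\{1,\dots,n\},\ y\in[0,1]\}$ in $R_{n,1}$. The circular $n$-diagram $C$ is $I$ together with one circular component, the circle of radius $1/4$ with centre $(1/2,1/2)$. With $a(n)=\max\{5,(n-1)(n-2)/2\}$, the diapsidal $n$-diagram $H^i$ ($1\le i\le n-1$) in $R_{n,a(n)}$ has no circular components, has a single cup, a semicircle with end points $(i,a(n))$ and $(i+1,a(n))$, a single cap, a semicircle with end points $(i,0)$ and $(i+1,0)$, and all its other threads are vertical straight line segments $\{j\}\times[0,a(n)]$ for $j\in\{1,\dots,n\}\setminus\{i,i+1\}$. The map $\delta$ from terms to $n$-diagrams is defined by $\delta(h^i)=H^i$, $\delta(c)=C$, $\delta(\mathbf 1)=I$, $\delta(tu)=\delta(t)\circ\delta(u)$. Slope points. Let $D$ be an $n$-diagram in $R_{n,a}$. If a thread of $D$ has end points $(i,a)$ and $(j,x)$ with $x\in\{0,a\}$ and $i<j$, then $(i,a)$ is a top slope point of $D$. If a thread of $D$ has end points $(i,x)$ and $(j,0)$ with $x\in\{0,a\}$ and $i<j$, then $(j,0)$ is a bottom slope point of $D$. In every $n$-diagram the numbers of top and of bottom slope points are equal. Let $(p_1,a),\dots,(p_r,a)$ with $p_1<\dots<p_r$ be all the top slope points of $D$, and $(q_1+1,0),\dots,(q_r+1,0)$ with $q_1<\dots<q_r$ all the bottom slope points of $D$. Then $T_D$ is the sequence $p_1,\dots,p_r$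 and $B_D$ is the sequence $q_1,\dots,q_r$. *)

theory Defs
  imports "HOL-Analysis.Analysis"
begin

(* The data type is independent of n; the terms for a given n are those satisfying wf_term n. *)
datatype trm = Hgen nat | Cgen | Unit | Mult trm trm

primrec wf_term :: "nat \<Rightarrow> trm \<Rightarrow> bool" where
  "wf_term n (Hgen i) \<longleftrightarrow> 1 \<le> i \<and> i \<le> n - 1"
| "wf_term n Cgen \<longleftrightarrow> True"
| "wf_term n Unit \<longleftrightarrow> True"
| "wf_term n (Mult t u) \<longleftrightarrow> wf_term n t \<and> wf_term n u"

(* Left-associated product; the value at [] plays no role. *)
fun lprod :: "trm list \<Rightarrow> trm" where
  "lprod [] = Unit"
| "lprod (t # ts) = foldl Mult t ts"

(* block i j is h^i h^(i-1) ... h^(j+1) h^j *)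
definition block :: "nat \<Rightarrow> nat \<Rightarrow> trm" where
  "block i j = lprod (map Hgen (rev [j..<Suc i]))"


definition boundary_points :: "'a::topological_space set \<Rightarrow> 'a set" where
  "boundary_points M = {p \<in> M. \<exists>U f g. openin (top_of_set M) U \<and> p \<in> U \<and>
     homeomorphism U {0::real..} f g \<and> f p = 0}"

(* Second countability and the Hausdorff property are inherited from the ambient plane. *)
definition one_manifold_with_boundary :: "(real \<times> real) set \<Rightarrow> bool" where
  "one_manifold_with_boundary M \<longleftrightarrow>
     (\<forall>p\<in>M. p \<in> boundary_points M \<or>
        (\<exists>U. openin (top_of_set M) U \<and> p \<in> U \<and> U homeomorphic (UNIV :: real set)))"

(* A subset of the plane together with the height a of the rectangle R_(n,a) it is drawn in. *)
record diagram =
  pts :: "(real \<times> real) set"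
  height :: real

definition n_diagram :: "nat \<Rightarrow> diagram \<Rightarrow> bool" where
  "n_diagram n D \<longleftrightarrow>
     (let a = height D; M = pts D;
          top_pts = (\<lambda>i. (real i, a)) ` {1..n};
          bot_pts = (\<lambda>i. (real i, 0)) ` {1..n}
      in 0 < a \<and> compact M \<and> one_manifold_with_boundary M \<and> finite (components M) \<and>
         M \<subseteq> {0..real n + 1} \<times> {0..a} \<and>
         M \<inter> ({0..real n + 1} \<times> {a}) = top_pts \<and>
         M \<inter> ({0..real n + 1} \<times> {0}) = bot_pts \<and>
         boundary_points M = top_pts \<union> bot_pts)"

(* compose D2 D1 places D1 above D2. *)
definition compose :: "diagram \<Rightarrow> diagram \<Rightarrow> diagram" where
  "compose D2 D1 =
     \<lparr>pts = (\<lambda>(x, y). (x, y + height D2)) ` pts D1 \<union> pts D2, height = height D1 + height D2\<rparr>"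

definition unit_diagram :: "nat \<Rightarrow> diagram" where
  "unit_diagram n = \<lparr>pts = real ` {1..n} \<times> {0..1}, height = 1\<rparr>"

definition circular_diagram :: "nat \<Rightarrow> diagram" where
  "circular_diagram n =
     \<lparr>pts = pts (unit_diagram n) \<union> sphere (1/2, 1/2) (1/4), height = 1\<rparr>"

definition diapsis_height :: "nat \<Rightarrow> real" where
  "diapsis_height n = max 5 ((real n - 1) * (real n - 2) / 2)"

definition diapsidal_diagram :: "nat \<Rightarrow> nat \<Rightarrow> diagram" where
  "diapsidal_diagram n i =
     (let a = diapsis_height n in
      \<lparr>pts = (sphere (real i + 1/2, a) (1/2) \<inter> {(x, y). y \<le> a}) \<union>
             (sphere (real i + 1/2, 0) (1/2) \<inter> {(x, y). 0 \<le> y}) \<union>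
             (real ` ({1..n} - {i, i + 1}) \<times> {0..a}),
       height = a\<rparr>)"

primrec delta :: "nat \<Rightarrow> trm \<Rightarrow> diagram" where
  "delta n (Hgen i) = diapsidal_diagram n i"
| "delta n Cgen = circular_diagram n"
| "delta n Unit = unit_diagram n"
| "delta n (Mult t u) = compose (delta n t) (delta n u)"


definition threads :: "diagram \<Rightarrow> (real \<times> real) set set" where
  "threads D = {K \<in> components (pts D). K homeomorphic {0..1::real}}"

definition has_end_points :: "(real \<times> real) set \<Rightarrow> real \<times> real \<Rightarrow> real \<times> real \<Rightarrow> bool" where
  "has_end_points K p q \<longleftrightarrow> (\<exists>f g. homeomorphism {0..1::real} K f g \<and> f 0 = p \<and> f 1 = q)"

definition top_slope_points :: "nat \<Rightarrow> diagram \<Rightarrow> (real \<times> real) set" where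
  "top_slope_points n D =
     {(real i, height D) | i. i \<in> {1..n} \<and>
        (\<exists>j\<in>{1..n}. \<exists>x\<in>{0, height D}. \<exists>K\<in>threads D.
           has_end_points K (real i, height D) (real j, x) \<and> i < j)}"

definition bottom_slope_points :: "nat \<Rightarrow> diagram \<Rightarrow> (real \<times> real) set" where
  "bottom_slope_points n D =
     {(real j, 0) | j. j \<in> {1..n} \<and>
        (\<exists>i\<in>{1..n}. \<exists>x\<in>{0, height D}. \<exists>K\<in>threads D.
           has_end_points K (real i, x) (real j, 0) \<and> i < j)}"

(* Both sets of indices below are subsets of {..n}, hence finite. *)
definition T_seq :: "nat \<Rightarrow> diagram \<Rightarrow> nat list" where
  "T_seq n D = sorted_list_of_set {p. (real p, height D) \<in> top_slope_points n D}"

definition B_seq :: "nat \<Rightarrow> diagram \<Rightarrow> nat list" where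
  "B_seq n D = sorted_list_of_set {q. (real q + 1, 0) \<in> bottom_slope_points n D}"

end

theory Submission
  imports Defs
begin

text \<open>
  A product of generators \<open>h\<^sup>i\<close> is drawn by stacking diapsidal diagrams, the leftmost factor at the
  bottom. So the diagram of a word arises from that of its last letter by adding one diapsis at a
  time from below, and one such addition changes the way the boundary points are joined very
  little: the threads that ended at the bottom points \<open>i\<close> and \<open>i + 1\<close> are joined to each other by
  the cup of the new diapsis, and these two bottom points are now joined by its cap. On matchings of
  boundary points this is the operation \<open>hook\<close>.

  The topological half of the proof shows that threads of the drawn diagram really follow this
  matching. An \<open>arc_system\<close> is a family of pairwise disjoint arcs which join the boundary points
  according to a matching, together with a compact remainder for the circular components. Because
  finitely many arcs and the remainder are disjoint and compact, each arc is a connected component;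
  because an arc determines its pair of end points, the slope points can be read off the matching
  (\<open>realizes_T_seq\<close>, \<open>realizes_B_seq\<close>). Adding a diapsis extends the arcs by vertical segments and
  glues two of them with the cup; \<open>realizes_compose_diapsidal\<close> states that the new matching is the
  hooked one.

  The combinatorial half follows the slopes through a word. When the strand at \<open>i\<close> is still straight
  and bottom point \<open>i + 1\<close> is not a slope point, adding \<open>h\<^sup>i\<close> creates the top slope point \<open>i\<close> and
  the bottom slope point \<open>i + 1\<close> and changes no other (\<open>slopes_hook_open\<close>). When \<open>h\<^sup>i\<close> has just been
  added and bottom point \<open>i + 2\<close> is not a slope point, adding \<open>h\<^bsup>i+1\<^esup>\<close> only moves the bottom slope
  point from \<open>i + 1\<close> to \<open>i + 2\<close> (\<open>slopes_hook_slide\<close>). Hence a block \<open>h\<^bsup>[b,a]\<^esup>\<close>, whose lowest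
  letter is \<open>h\<^sup>b\<close>, adds the top slope point \<open>a\<close> and the bottom slope point \<open>b + 1\<close>. Since \<open>a\<close> and \<open>b\<close>
  strictly decrease from one block to the next one below it, all strands and bottom points that the
  next block meets are as required, and the slopes of the blocks accumulate.
\<close>

section \<open>Arcs with prescribed end points\<close>

lemma has_end_points_iff_arc:
  "has_end_points K p q \<longleftrightarrow> (\<exists>g. arc g \<and> path_image g = K \<and> pathstart g = p \<and> pathfinish g = q)"
proof
  assume "has_end_points K p q"
  then obtain f g where fg: "homeomorphism {0..1::real} K f g" "f 0 = p" "f 1 = q"
    unfolding has_end_points_def by blast
  have "inj_on f {0..1}"
    using fg(1) by (metis homeomorphism_apply1 inj_on_inverseI)
  with fg have "arc f" "path_image f = K" "pathstart f = p" "pathfinish f = q"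
    by (auto simp: arc_def path_def path_image_def pathstart_def pathfinish_def
        homeomorphism_cont1 homeomorphism_image1)
  then show "\<exists>g. arc g \<and> path_image g = K \<and> pathstart g = p \<and> pathfinish g = q"
    by blast
next
  assume "\<exists>g. arc g \<and> path_image g = K \<and> pathstart g = p \<and> pathfinish g = q"
  then show "has_end_points K p q"
    unfolding has_end_points_def
    by (metis homeomorphism_arc pathfinish_def pathstart_def)
qed

lemma has_end_points_imp_homeomorphic:
  "has_end_points K p q \<Longrightarrow> K homeomorphic {0..1::real}"
  unfolding has_end_points_def using homeomorphic_def homeomorphic_sym by blast

lemma has_end_points_compact: "has_end_points K p q \<Longrightarrow> compact K"
  using has_end_points_iff_arc compact_arc_image by metis

lemma has_end_points_connected: "has_end_points K p q \<Longrightarrow> connected K"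
  using has_end_points_iff_arc connected_arc_image by metis

lemma has_end_points_mem: "has_end_points K p q \<Longrightarrow> p \<in> K \<and> q \<in> K"
  using has_end_points_iff_arc by (metis pathfinish_in_path_image pathstart_in_path_image)

lemma has_end_points_sym: "has_end_points K p q \<Longrightarrow> has_end_points K q p"
  unfolding has_end_points_iff_arc
  by (metis arc_reversepath path_image_reversepath pathfinish_reversepath pathstart_reversepath)

lemma has_end_points_join:
  assumes "has_end_points A p q" "has_end_points B q r" "A \<inter> B \<subseteq> {q}"
  shows "has_end_points (A \<union> B) p r"
proof -
  obtain f g where "arc f" "path_image f = A" "pathstart f = p" "pathfinish f = q"
    "arc g" "path_image g = B" "pathstart g = q" "pathfinish g = r"
    using assms(1,2) unfolding has_end_points_iff_arc by metis
  with assms(3) have "arc (f +++ g)" "path_image (f +++ g) = A \<union> B"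
    "pathstart (f +++ g) = p" "pathfinish (f +++ g) = r"
    by (auto simp: arc_join path_image_join)
  then show ?thesis unfolding has_end_points_iff_arc by blast
qed

lemma has_end_points_translation:
  assumes "has_end_points K p q"
  shows "has_end_points ((+) c ` K) (c + p) (c + q)"
proof -
  obtain f where "arc f" "path_image f = K" "pathstart f = p" "pathfinish f = q"
    using assms unfolding has_end_points_iff_arc by metis
  then have "arc ((+) c \<circ> f)" "path_image ((+) c \<circ> f) = (+) c ` K"
    "pathstart ((+) c \<circ> f) = c + p" "pathfinish ((+) c \<circ> f) = c + q"
    by (auto simp: arc_translation_eq path_image_translation pathstart_def pathfinish_def)
  then show ?thesis unfolding has_end_points_iff_arc by blast
qed

lemma has_end_points_segment:
  assumes "c < d"
  shows "has_end_points ({x} \<times> {c..d}) (x, c) (x, d)"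
proof -
  have eq: "closed_segment (x, c) (x, d) = {x} \<times> {c..d}"
  proof -
    have "(1 - u) *\<^sub>R (x, c) + u *\<^sub>R (x, d) = (x, (1 - u) *\<^sub>R c + u *\<^sub>R d)" for u
      by (simp add: algebra_simps)
    then have "closed_segment (x, c) (x, d) = Pair x ` closed_segment c d"
      unfolding closed_segment_def by auto
    then show ?thesis using assms by (auto simp: closed_segment_eq_real_ivl)
  qed
  show ?thesis unfolding has_end_points_iff_arc eq[symmetric]
    using assms by (intro exI[of _ "linepath (x, c) (x, d)"]) (auto simp: arc_linepath)
qed

text \<open>
  End points are a topological notion: removing an interior point disconnects an interval, removing
  an end point does not.
\<close>

lemma homeomorphism_unit_interval_end:
  assumes h: "homeomorphism {0..1::real} {0..1::real} h k" and x: "x \<in> {0, 1}"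
  shows "h x \<in> {0, 1}"
proof (rule ccontr)
  assume neq: "h x \<notin> {0, 1}"
  have "h x \<in> {0..1}" using homeomorphism_image1[OF h] x by auto
  with neq have hx: "0 < h x" "h x < 1" by auto
  have "connected ({0..1} - {x})"
  proof -
    have "{0..1} - {x} = (if x = 0 then {0<..1} else {0..<1::real})" using x by auto
    then show ?thesis by (auto split: if_splits)
  qed
  moreover have "continuous_on ({0..1} - {x}) h"
    using homeomorphism_cont1[OF h] continuous_on_subset by blast
  ultimately have "connected (h ` ({0..1} - {x}))" using connected_continuous_image by blast
  moreover have "h ` ({0..1} - {x}) = {0..1} - {h x}"
  proof -
    have "inj_on h {0..1}" using homeomorphism_apply1[OF h] by (metis inj_on_inverseI)
    then have "h ` ({0..1} - {x}) = h ` {0..1} - h ` {x}"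
      by (rule inj_on_image_set_diff) (use x in auto)
    then show ?thesis using homeomorphism_image1[OF h] by simp
  qed
  ultimately have "is_interval ({0..1} - {h x})" using is_interval_connected_1 by metis
  moreover have "0 \<in> {0..1} - {h x}" "1 \<in> {0..1} - {h x}" using hx by auto
  ultimately have "h x \<in> {0..1} - {h x}"
    unfolding is_interval_1 using hx less_imp_le by blast
  then show False by simp
qed

text \<open>
  Two parametrisations of an arc differ by a homeomorphism of the unit interval, so the pair of end
  points belongs to the set and not to the parametrisation.
\<close>

lemma end_points_unique:
  assumes "has_end_points K p q" "has_end_points K p' q'"
  shows "{p, q} = {p', q'}"
proof -
  obtain f g f' g' where f: "homeomorphism {0..1::real} K f g" "f 0 = p" "f 1 = q"
    and f': "homeomorphism {0..1::real} K f' g'" "f' 0 = p'" "f' 1 = q'"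
    using assms unfolding has_end_points_def by metis
  have "homeomorphism {0..1} {0..1} (g \<circ> f') (g' \<circ> f)"
    using homeomorphism_compose[OF f'(1) homeomorphism_symD[OF f(1)]] .
  then have "(g \<circ> f') x \<in> {0, 1}" if "x \<in> {0, 1}" for x
    using homeomorphism_unit_interval_end that by blast
  moreover have "f ((g \<circ> f') x) = f' x" if "x \<in> {0, 1}" for x
  proof -
    have "f' x \<in> K" using homeomorphism_image1[OF f'(1)] that by auto
    then show ?thesis by (simp add: homeomorphism_apply2[OF f(1)])
  qed
  ultimately have "f' 0 \<in> {p, q}" "f' 1 \<in> {p, q}"
    using f by (metis insert_iff singletonD)+
  moreover have "f' 0 \<noteq> f' 1"
    using homeomorphism_apply1[OF f'(1), of 0] homeomorphism_apply1[OF f'(1), of 1] by auto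
  ultimately show ?thesis using f' by auto
qed

text \<open>A lower semicircle is the graph of a function of the abscissa, hence an arc.\<close>

lemma has_end_points_lower_semicircle:
  assumes "0 < r"
  shows "has_end_points (sphere (x, y) r \<inter> {(u, v). v \<le> y}) (x - r, y) (x + r, y)"
proof -
  define g where "g s = (x - r + s * (2 * r), y - sqrt (r\<^sup>2 - (s * (2 * r) - r)\<^sup>2))" for s
  have "arc g"
    unfolding arc_def path_def g_def using assms
    by (auto intro!: continuous_intros inj_onI)
  moreover have "path_image g = sphere (x, y) r \<inter> {(u, v). v \<le> y}" (is "_ = ?S")
  proof (intro equalityI subsetI)
    fix z assume "z \<in> path_image g"
    then obtain s where s: "s \<in> {0..1}" "z = g s" unfolding path_image_def by auto
    have "\<bar>s * (2 * r) - r\<bar> \<le> \<bar>r\<bar>"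
    proof -
      have "s * r \<le> 1 * r" using s assms by (intro mult_right_mono) auto
      moreover have "0 \<le> s * r" using s assms by auto
      ultimately show ?thesis by (auto simp: abs_if mult.commute)
    qed
    then have le: "(s * (2 * r) - r)\<^sup>2 \<le> r\<^sup>2" using abs_le_square_iff by blast
    have "dist (x, y) (g s) = r"
      using le assms by (auto simp: g_def dist_Pair_Pair dist_real_def power2_commute)
    with s le show "z \<in> ?S" by (auto simp: g_def)
  next
    fix z assume z: "z \<in> ?S"
    obtain u v where uv: "z = (u, v)" by fastforce
    have "dist (x, y) (u, v) = r" using z uv by simp
    then have "sqrt ((x - u)\<^sup>2 + (y - v)\<^sup>2) = r" by (simp add: dist_Pair_Pair dist_real_def)
    then have "(x - u)\<^sup>2 + (y - v)\<^sup>2 = r\<^sup>2"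
      by (metis add_nonneg_nonneg real_sqrt_pow2 zero_le_power2)
    then have v: "r\<^sup>2 - (x - u)\<^sup>2 = (y - v)\<^sup>2" by simp
    then have "\<bar>x - u\<bar> \<le> \<bar>r\<bar>"
      by (metis abs_le_square_iff diff_ge_0_iff_ge zero_le_power2)
    then have u: "x - r \<le> u" "u \<le> x + r" using assms by auto
    define s where "s = (u - (x - r)) / (2 * r)"
    have s1: "s * (2 * r) = u - (x - r)" using assms by (simp add: s_def)
    have "s \<in> {0..1}" using u assms by (auto simp: s_def divide_simps)
    moreover have "g s = (u, v)"
    proof -
      have "r\<^sup>2 - (s * (2 * r) - r)\<^sup>2 = (y - v)\<^sup>2"
        using v by (simp add: s1 power2_commute)
      moreover have "v \<le> y" using z uv by simp
      ultimately show ?thesis by (simp add: g_def s1)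
    qed
    ultimately show "z \<in> path_image g" unfolding path_image_def uv by (metis imageI)
  qed
  moreover have "pathstart g = (x - r, y)" "pathfinish g = (x + r, y)"
    by (auto simp: g_def pathstart_def pathfinish_def)
  ultimately show ?thesis unfolding has_end_points_iff_arc by blast
qed

lemma has_end_points_upper_semicircle:
  assumes "0 < r"
  shows "has_end_points (sphere (x, y) r \<inter> {(u, v). y \<le> v}) (x - r, y) (x + r, y)"
proof -
  obtain f where f: "arc f" "path_image f = sphere (x, -y) r \<inter> {(u, v). v \<le> -y}"
    "pathstart f = (x - r, -y)" "pathfinish f = (x + r, -y)"
    using has_end_points_lower_semicircle[OF assms, of x "-y"] unfolding has_end_points_iff_arc
    by auto
  define R where "R = (\<lambda>(u, v). (u, -v :: real) :: real \<times> real)"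
  have "linear R" by (rule linearI) (auto simp: R_def)
  moreover have "inj R" by (rule injI) (auto simp: R_def)
  ultimately have "arc (R \<circ> f)" using f(1) arc_linear_image_eq by blast
  moreover have "path_image (R \<circ> f) = sphere (x, y) r \<inter> {(u, v). y \<le> v}"
  proof -
    have R: "R (R z) = z" for z by (cases z) (simp add: R_def)
    have "z \<in> R ` path_image f \<longleftrightarrow> R z \<in> path_image f" for z
      using R by (metis image_iff)
    moreover have "R z \<in> path_image f \<longleftrightarrow> z \<in> sphere (x, y) r \<inter> {(u, v). y \<le> v}" for z
      by (cases z) (auto simp: f R_def dist_Pair_Pair dist_real_def power2_commute add.commute)
    ultimately show ?thesis unfolding path_image_compose by blast
  qed
  moreover have "pathstart (R \<circ> f) = (x - r, y)" "pathfinish (R \<circ> f) = (x + r, y)"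
    using f by (auto simp: R_def pathstart_compose pathfinish_compose)
  ultimately show ?thesis unfolding has_end_points_iff_arc by blast
qed

section \<open>Matchings of boundary points and the arcs realizing them\<close>

text \<open>
  The nodes are the combinatorial names of the \<open>2n\<close> boundary points; a diagram without regard to its
  shape and its circular components is a fixed-point-free involution on them.
\<close>

datatype node = Top (pos: nat) | Bot (pos: nat)

definition nodes :: "nat \<Rightarrow> node set" where
  "nodes n = Top ` {1..n} \<union> Bot ` {1..n}"

primrec node_pt :: "real \<Rightarrow> node \<Rightarrow> real \<times> real" where
  "node_pt h (Top i) = (real i, h)"
| "node_pt h (Bot i) = (real i, 0)"

definition matching :: "nat \<Rightarrow> (node \<Rightarrow> node) \<Rightarrow> bool" where
  "matching n m \<longleftrightarrow> (\<forall>v\<in>nodes n. m v \<in> nodes n \<and> m v \<noteq> v \<and> m (m v) = v)"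

text \<open>
  The matching of a diagram below which the diapsis with index \<open>i\<close> is placed. If \<open>m\<close> joins
  \<open>Bot i\<close> and \<open>Bot (Suc i)\<close>, the cup closes this thread to a circle, and the matching stays
  as it is: the last case then covers all other nodes.
\<close>

definition hook :: "nat \<Rightarrow> (node \<Rightarrow> node) \<Rightarrow> node \<Rightarrow> node" where
  "hook i m v =
     (if v = Bot i then Bot (Suc i)
      else if v = Bot (Suc i) then Bot i
      else if v = m (Bot i) then m (Bot (Suc i))
      else if v = m (Bot (Suc i)) then m (Bot i)
      else m v)"

primrec straight :: "node \<Rightarrow> node" where
  "straight (Top i) = Bot i"
| "straight (Bot i) = Top i"

lemma Top_in_nodes [simp]: "Top i \<in> nodes n \<longleftrightarrow> i \<in> {1..n}"
  by (auto simp: nodes_def)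

lemma Bot_in_nodes [simp]: "Bot i \<in> nodes n \<longleftrightarrow> i \<in> {1..n}"
  by (auto simp: nodes_def)

lemma finite_nodes [simp]: "finite (nodes n)"
  by (simp add: nodes_def)

lemma matching_straight: "matching n straight"
  by (auto simp: matching_def nodes_def)

lemma matchingD:
  assumes "matching n m" "v \<in> nodes n"
  shows "m v \<in> nodes n" "m v \<noteq> v" "m (m v) = v"
  using assms by (auto simp: matching_def)

lemma matching_inj:
  assumes "matching n m" "u \<in> nodes n" "v \<in> nodes n"
  shows "m u = m v \<longleftrightarrow> u = v"
  using assms unfolding matching_def by metis

lemma matching_hook:
  assumes "matching n m" "1 \<le> i" "i < n"
  shows "matching n (hook i m)"
proof -
  have B: "Bot i \<in> nodes n" "Bot (Suc i) \<in> nodes n" using assms by auto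
  note D = matchingD[OF assms(1)]
  show ?thesis
    unfolding matching_def
  proof (intro ballI conjI)
    fix v assume v: "v \<in> nodes n"
    show "hook i m v \<in> nodes n" using D(1) B v by (auto simp: hook_def)
    show "hook i m v \<noteq> v" using D B v unfolding hook_def by (smt (verit) node.inject(2) n_not_Suc_n)
    show "hook i m (hook i m v) = v"
      using D B v unfolding hook_def by (smt (verit) node.inject(2) n_not_Suc_n)
  qed
qed

text \<open>
  Arcs \<open>K v\<close> that realize the matching \<open>m\<close> in a strip of height \<open>h\<close>; the set \<open>R\<close> contains what
  lies on circular components. The arcs meet the line at height \<open>0\<close> in bottom points
  only and \<open>R\<close> stays away from it, which controls what is touched when something is glued from below.
\<close>

locale arc_system =
  fixes n :: nat and h :: real and m :: "node \<Rightarrow> node"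
    and K :: "node \<Rightarrow> (real \<times> real) set" and R :: "(real \<times> real) set"
  assumes height_pos: "0 < h"
    and matching: "matching n m"
    and arc: "v \<in> nodes n \<Longrightarrow> has_end_points (K v) (node_pt h v) (node_pt h (m v))"
    and same_arc: "v \<in> nodes n \<Longrightarrow> K (m v) = K v"
    and disjoint: "\<lbrakk>u \<in> nodes n; v \<in> nodes n; u \<noteq> v; u \<noteq> m v\<rbrakk> \<Longrightarrow> K u \<inter> K v = {}"
    and above: "\<lbrakk>v \<in> nodes n; z \<in> K v\<rbrakk> \<Longrightarrow> 0 \<le> snd z"
    and floor: "\<lbrakk>v \<in> nodes n; z \<in> K v; snd z = 0\<rbrakk> \<Longrightarrow> \<exists>j\<in>{1..n}. z = (real j, 0)"
    and rest_compact: "compact R"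
    and rest_disjoint: "v \<in> nodes n \<Longrightarrow> K v \<inter> R = {}"
    and rest_above: "z \<in> R \<Longrightarrow> 0 < snd z"
begin

abbreviation carrier :: "(real \<times> real) set" where
  "carrier \<equiv> \<Union> (K ` nodes n) \<union> R"

lemma nodeD: "v \<in> nodes n \<Longrightarrow> m v \<in> nodes n" "v \<in> nodes n \<Longrightarrow> m v \<noteq> v"
    "v \<in> nodes n \<Longrightarrow> m (m v) = v"
  using matchingD[OF matching] by auto

text \<open>
  The union \<open>Q\<close> of the other arcs and of \<open>R\<close> is compact and disjoint from \<open>K v\<close>, so a connected
  set that meets \<open>K v\<close> cannot leave it.
\<close>

lemma arc_is_component:
  assumes v: "v \<in> nodes n"
  shows "K v \<in> components carrier"
  unfolding in_components_maximal
proof (intro conjI allI impI)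
  define Q where "Q = \<Union> (K ` (nodes n - {v, m v})) \<union> R"
  have split: "carrier = K v \<union> Q" using v same_arc[OF v] by (auto simp: Q_def)
  have disj: "K v \<inter> Q = {}"
    using disjoint[OF _ v] rest_disjoint[OF v] by (fastforce simp: Q_def)
  have "compact Q"
    unfolding Q_def using rest_compact has_end_points_compact[OF arc]
    by (intro compact_Un compact_UN) auto
  then have cl: "closed Q" "closed (K v)"
    using compact_imp_closed has_end_points_compact[OF arc[OF v]] by auto
  show ne: "K v \<noteq> {}" using has_end_points_mem[OF arc[OF v]] by auto
  show "K v \<subseteq> carrier" using v by auto
  show "connected (K v)" using has_end_points_connected[OF arc[OF v]] .
  fix S assume S: "S \<noteq> {} \<and> K v \<subseteq> S \<and> S \<subseteq> carrier \<and> connected S"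
  then have "S \<subseteq> K v \<union> Q" "K v \<inter> S \<noteq> {}" using split ne by auto
  then have "Q \<inter> S = {}"
    using S connected_closedD[of S "K v" Q] cl disj by blast
  then show "S = K v" using S split by auto
qed

text \<open>
  The diagram is given as a point set only, so a thread in the sense of the definition is first
  identified with an arc of the family, since both are components through the same boundary point.
\<close>

lemma thread_at_node:
  assumes v: "v \<in> nodes n" and D: "pts D = carrier"
    and T: "T \<in> threads D" "has_end_points T (node_pt h v) q"
  shows "q = node_pt h (m v)"
proof -
  have "T \<in> components carrier" using T(1) D by (simp add: threads_def)
  moreover have "T \<inter> K v \<noteq> {}"
    using has_end_points_mem[OF T(2)] has_end_points_mem[OF arc[OF v]] by auto
  ultimately have "T = K v" using arc_is_component[OF v] components_eq by blast
  with T(2) have eq: "{node_pt h v, q} = {node_pt h v, node_pt h (m v)}"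
    using end_points_unique arc[OF v] by blast
  moreover have "node_pt h (m v) \<noteq> node_pt h v"
    using nodeD(2)[OF v] height_pos by (cases v; cases "m v") auto
  ultimately show ?thesis by (metis doubleton_eq_iff)
qed

lemma arc_is_thread:
  assumes "v \<in> nodes n" "pts D = carrier"
  shows "K v \<in> threads D"
  using arc_is_component[OF assms(1)] has_end_points_imp_homeomorphic[OF arc[OF assms(1)]] assms(2)
  by (simp add: threads_def)

lemma slope_points:
  assumes D: "pts D = carrier" "height D = h"
  shows "(real p, height D) \<in> top_slope_points n D \<longleftrightarrow> p \<in> {1..n} \<and> p < pos (m (Top p))"
    and "(real p, 0) \<in> bottom_slope_points n D \<longleftrightarrow> p \<in> {1..n} \<and> pos (m (Bot p)) < p"
proof -
  have node: "\<exists>x\<in>{0, h}. node_pt h w = (real (pos w), x)" for w by (cases w) auto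
  show "(real p, height D) \<in> top_slope_points n D \<longleftrightarrow> p \<in> {1..n} \<and> p < pos (m (Top p))"
    (is "?l \<longleftrightarrow> ?r")
  proof
    assume ?l
    then obtain j x T where *: "p \<in> {1..n}" "T \<in> threads D" "p < j"
        "has_end_points T (node_pt h (Top p)) (real j, x)"
      unfolding top_slope_points_def D by auto
    then have "(real j, x) = node_pt h (m (Top p))" by (intro thread_at_node[OF _ D(1)]) auto
    then have "j = pos (m (Top p))" by (cases "m (Top p)") auto
    with * show ?r by simp
  next
    assume r: ?r
    then have v: "Top p \<in> nodes n" by simp
    have "pos (m (Top p)) \<in> {1..n}" using nodeD(1)[OF v] by (cases "m (Top p)") auto
    moreover obtain x where "x \<in> {0, h}" "node_pt h (m (Top p)) = (real (pos (m (Top p))), x)"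
      using node by blast
    ultimately show ?l
      using r arc_is_thread[OF v D(1)] arc[OF v] unfolding top_slope_points_def D
      by auto
  qed
  show "(real p, 0) \<in> bottom_slope_points n D \<longleftrightarrow> p \<in> {1..n} \<and> pos (m (Bot p)) < p"
    (is "?l \<longleftrightarrow> ?r")
  proof
    assume ?l
    then obtain j x T where *: "p \<in> {1..n}" "T \<in> threads D" "j < p"
        "has_end_points T (real j, x) (node_pt h (Bot p))"
      unfolding bottom_slope_points_def D by auto
    then have "(real j, x) = node_pt h (m (Bot p))"
      by (intro thread_at_node[OF _ D(1) _ has_end_points_sym]) auto
    then have "j = pos (m (Bot p))" by (cases "m (Bot p)") auto
    with * show ?r by simp
  next
    assume r: ?r
    then have v: "Bot p \<in> nodes n" by simp
    have "pos (m (Bot p)) \<in> {1..n}" using nodeD(1)[OF v] by (cases "m (Bot p)") auto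
    moreover obtain x where "x \<in> {0, h}" "node_pt h (m (Bot p)) = (real (pos (m (Bot p))), x)"
      using node by blast
    ultimately show ?l
      using r arc_is_thread[OF v D(1)] has_end_points_sym[OF arc[OF v]]
      unfolding bottom_slope_points_def D
      by auto
  qed
qed

end

definition realizes :: "nat \<Rightarrow> diagram \<Rightarrow> (node \<Rightarrow> node) \<Rightarrow> bool" where
  "realizes n D m \<longleftrightarrow>
     (\<exists>K R. arc_system n (height D) m K R \<and> pts D = \<Union> (K ` nodes n) \<union> R)"

definition top_slopes :: "nat \<Rightarrow> (node \<Rightarrow> node) \<Rightarrow> nat set" where
  "top_slopes n m = {p \<in> {1..n}. p < pos (m (Top p))}"

definition bottom_slopes :: "nat \<Rightarrow> (node \<Rightarrow> node) \<Rightarrow> nat set" where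
  "bottom_slopes n m = {q \<in> {1..n}. pos (m (Bot q)) < q}"

lemma realizes_T_seq:
  assumes "realizes n D m"
  shows "T_seq n D = sorted_list_of_set (top_slopes n m)"
proof -
  obtain K R where "arc_system n (height D) m K R" "pts D = \<Union> (K ` nodes n) \<union> R"
    using assms unfolding realizes_def by blast
  then have "(real p, height D) \<in> top_slope_points n D \<longleftrightarrow> p \<in> top_slopes n m" for p
    using arc_system.slope_points(1)[of n "height D" m K R D p] by (simp add: top_slopes_def)
  then show ?thesis by (simp add: T_seq_def)
qed

lemma realizes_B_seq:
  assumes "realizes n D m"
  shows "B_seq n D = sorted_list_of_set {q. Suc q \<in> bottom_slopes n m}"
proof -
  obtain K R where "arc_system n (height D) m K R" "pts D = \<Union> (K ` nodes n) \<union> R"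
    using assms unfolding realizes_def by blast
  then have "(real q + 1, 0) \<in> bottom_slope_points n D \<longleftrightarrow> Suc q \<in> bottom_slopes n m" for q
    using arc_system.slope_points(2)[of n "height D" m K R D "Suc q"]
    by (simp add: bottom_slopes_def add.commute)
  then show ?thesis by (simp add: B_seq_def)
qed

section \<open>Placing a diapsis below an arc system\<close>

definition cup :: "nat \<Rightarrow> real \<Rightarrow> (real \<times> real) set" where
  "cup i y = sphere (real i + 1/2, y) (1/2) \<inter> {(u, v). v \<le> y}"

definition cap :: "nat \<Rightarrow> real \<Rightarrow> (real \<times> real) set" where
  "cap i y = sphere (real i + 1/2, y) (1/2) \<inter> {(u, v). y \<le> v}"

lemma has_end_points_cup: "has_end_points (cup i y) (real i, y) (real (Suc i), y)"
  using has_end_points_lower_semicircle[of "1/2" "real i + 1/2" y] by (simp add: cup_def add.commute)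

lemma has_end_points_cap: "has_end_points (cap i y) (real i, y) (real (Suc i), y)"
  using has_end_points_upper_semicircle[of "1/2" "real i + 1/2" y] by (simp add: cap_def add.commute)

lemma sphere_bounds:
  fixes x y u v r :: real
  assumes "(u, v) \<in> sphere (x, y) r"
  shows "\<bar>u - x\<bar> \<le> r" "\<bar>v - y\<bar> \<le> r"
  using assms dist_fst_le[of "(u, v)" "(x, y)"] dist_snd_le[of "(u, v)" "(x, y)"]
  by (auto simp: dist_real_def dist_commute)

lemma cup_bounds:
  assumes "z \<in> cup i y"
  shows "real i \<le> fst z" "fst z \<le> real (Suc i)" "y - 1/2 \<le> snd z" "snd z \<le> y"
proof -
  have "\<bar>fst z - (real i + 1/2)\<bar> \<le> 1/2" "\<bar>snd z - y\<bar> \<le> 1/2"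
    using assms sphere_bounds[of "fst z" "snd z" "real i + 1/2" y "1/2"] unfolding cup_def by auto
  then show "real i \<le> fst z" "fst z \<le> real (Suc i)" "y - 1/2 \<le> snd z" "snd z \<le> y"
    using assms unfolding cup_def abs_le_iff by auto
qed

lemma cap_bounds:
  assumes "z \<in> cap i y"
  shows "real i \<le> fst z" "fst z \<le> real (Suc i)" "y \<le> snd z" "snd z \<le> y + 1/2"
proof -
  have "\<bar>fst z - (real i + 1/2)\<bar> \<le> 1/2" "\<bar>snd z - y\<bar> \<le> 1/2"
    using assms sphere_bounds[of "fst z" "snd z" "real i + 1/2" y "1/2"] unfolding cap_def by auto
  then show "real i \<le> fst z" "fst z \<le> real (Suc i)" "y \<le> snd z" "snd z \<le> y + 1/2"
    using assms unfolding cap_def abs_le_iff by auto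
qed

lemma cap_floor:
  assumes "1 \<le> i" "i < n" "z \<in> cap i 0" "snd z = 0"
  shows "\<exists>j\<in>{1..n}. z = (real j, 0)"
proof -
  obtain u where z: "z = (u, 0)" using assms(4) by (cases z) auto
  have "\<bar>real i + 1/2 - u\<bar> = 1/2"
    using assms(3) unfolding z cap_def by (simp add: dist_Pair_Pair dist_real_def)
  then have "u = real i \<or> u = real (Suc i)" by (auto simp: abs_if field_simps split: if_splits)
  then obtain j where "j = i \<or> j = Suc i" "u = real j" by blast
  then show ?thesis using assms(1,2) unfolding z by auto
qed

lemma real_between_Suc: "real i \<le> real j \<Longrightarrow> real j \<le> real (Suc i) \<Longrightarrow> j = i \<or> j = Suc i"
  by linarith

text \<open>
  The arc system is shifted up by \<open>L\<close>, and below it a diapsis of height \<open>L\<close> is drawn. With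
  \<open>L > 1\<close> its two semicircles of radius \<open>1/2\<close> do not meet.

  The arcs are first extended by the vertical segments of the diapsis (\<open>extended\<close>). Such an arc ends
  at its foot, which is a boundary point of the new diagram unless the arc ended at \<open>Bot i\<close> or
  \<open>Bot (Suc i)\<close>; then the foot is an end point of the cup, at height \<open>L\<close>.
\<close>

locale hooked_arc_system = arc_system +
  fixes i :: nat and L :: real
  assumes i: "1 \<le> i" "i < n" and L: "1 < L"
begin

definition tail :: "node \<Rightarrow> (real \<times> real) set" where
  "tail v = (case v of Top j \<Rightarrow> {} | Bot j \<Rightarrow> if j = i \<or> j = Suc i then {} else {real j} \<times> {0..L})"

definition foot :: "node \<Rightarrow> real \<times> real" where
  "foot v = (case v of Top j \<Rightarrow> (real j, h + L)
     | Bot j \<Rightarrow> (real j, if j = i \<or> j = Suc i then L else 0))"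

definition extended :: "node \<Rightarrow> (real \<times> real) set" where
  "extended v = (+) (0, L) ` K v \<union> (tail v \<union> tail (m v))"

lemma extended_m: "v \<in> nodes n \<Longrightarrow> extended (m v) = extended v"
  using same_arc nodeD by (auto simp: extended_def)

lemma high: "\<lbrakk>v \<in> nodes n; z \<in> (+) (0, L) ` K v\<rbrakk> \<Longrightarrow> L \<le> snd z"
  using above by fastforce

lemma tail_bounds: "z \<in> tail v \<Longrightarrow> 0 \<le> snd z \<and> snd z \<le> L"
  by (auto simp: tail_def split: node.splits if_splits)

lemma tail_mem:
  "z \<in> tail v \<Longrightarrow> \<exists>j. v = Bot j \<and> fst z = real j \<and> j \<noteq> i \<and> j \<noteq> Suc i \<and> 0 \<le> snd z \<and> snd z \<le> L"
  by (cases v) (auto simp: tail_def split: if_splits)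

lemma node_mem_arc:
  assumes "v \<in> nodes n" "Bot j \<in> {v, m v}"
  shows "(real j, 0) \<in> K v"
  using has_end_points_mem[OF arc[OF assms(1)]] assms(2) by (metis insertE node_pt.simps(2) singletonD)

text \<open>
  Disjointness of the extended arcs is decided by height: at height \<open>L\<close> and below, the abscissa of a
  point names the bottom node whose arc it belongs to, and at height \<open>L\<close> and above only the shifted
  arc is left (\<open>extended_high\<close>).
\<close>

lemma extended_low:
  assumes v: "v \<in> nodes n" and z: "z \<in> extended v" "snd z \<le> L"
  shows "\<exists>j\<in>{1..n}. Bot j \<in> {v, m v} \<and> fst z = real j \<and> 0 \<le> snd z \<and> (j = i \<or> j = Suc i \<longrightarrow> snd z = L)"
proof -
  consider "z \<in> (+) (0, L) ` K v" | "z \<in> tail v" | "z \<in> tail (m v)"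
    using z unfolding extended_def by blast
  then show ?thesis
  proof cases
    case 1
    then obtain w where w: "w \<in> K v" "z = (0, L) + w" by blast
    with z have sw: "snd w = 0" using above[OF v w(1)] by simp
    then obtain j where j: "j \<in> {1..n}" "w = (real j, 0)" using floor[OF v w(1)] by blast
    have "w \<in> K (Bot j)" using has_end_points_mem[OF arc[of "Bot j"]] j by auto
    then have "Bot j = v \<or> Bot j = m v" using disjoint[of "Bot j" v] v w j by auto
    then show ?thesis using j w L by auto
  next
    case 2
    then show ?thesis using tail_mem[OF 2] v by auto
  next
    case 3
    then show ?thesis using tail_mem[OF 3] nodeD(1)[OF v] by auto
  qed
qed

lemma extended_high:
  assumes v: "v \<in> nodes n" and z: "z \<in> extended v" "L \<le> snd z"
  shows "z \<in> (+) (0, L) ` K v"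
proof (rule ccontr)
  assume "z \<notin> (+) (0, L) ` K v"
  then have "z \<in> tail v \<or> z \<in> tail (m v)" using z unfolding extended_def by blast
  then have sz: "snd z = L" using tail_bounds z(2) by fastforce
  then obtain j where "Bot j \<in> {v, m v}" "fst z = real j" using extended_low[OF v z(1)] by auto
  then have "(real j, 0) \<in> K v" "z = (0, L) + (real j, 0)"
    using node_mem_arc[OF v] sz by (auto simp: prod_eq_iff)
  with \<open>z \<notin> (+) (0, L) ` K v\<close> show False by blast
qed

lemma extended_disjoint:
  assumes "u \<in> nodes n" "v \<in> nodes n" "u \<noteq> v" "u \<noteq> m v"
  shows "extended u \<inter> extended v = {}"
proof (rule ccontr)
  assume "extended u \<inter> extended v \<noteq> {}"
  then obtain z where z: "z \<in> extended u" "z \<in> extended v" by blast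
  show False
  proof (cases "snd z \<le> L")
    case True
    obtain j where "Bot j \<in> {u, m u}" "fst z = real j"
      using extended_low[OF assms(1) z(1) True] by blast
    moreover obtain k where "Bot k \<in> {v, m v}" "fst z = real k"
      using extended_low[OF assms(2) z(2) True] by blast
    ultimately have "Bot j \<in> {u, m u}" "Bot j \<in> {v, m v}" by auto
    then show False using assms nodeD by (metis insertE singletonD)
  next
    case False
    then have "z \<in> (+) (0, L) ` K u" "z \<in> (+) (0, L) ` K v"
      using extended_high assms(1,2) z by auto
    then have "K u \<inter> K v \<noteq> {}" by auto
    then show False using disjoint assms by blast
  qed
qed

lemma prepend_tail:
  assumes "v \<in> nodes n" "has_end_points A ((0, L) + node_pt h v) q" "A \<inter> tail v \<subseteq> {(0, L) + node_pt h v}"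
  shows "has_end_points (tail v \<union> A) (foot v) q"
proof (cases "tail v = {}")
  case True
  then have "foot v = (0, L) + node_pt h v"
    using L by (cases v) (auto simp: tail_def foot_def split: if_splits)
  then show ?thesis using assms True by simp
next
  case False
  then obtain j where j: "v = Bot j" "j \<noteq> i" "j \<noteq> Suc i"
    by (cases v) (auto simp: tail_def split: if_splits)
  then have "has_end_points (tail v) (foot v) ((0, L) + node_pt h v)"
    using has_end_points_segment[of 0 L "real j"] L by (simp add: tail_def foot_def)
  then show ?thesis using has_end_points_join assms(2,3) by (metis Int_commute)
qed

lemma shifted_tail:
  assumes v: "v \<in> nodes n" and w: "w \<in> nodes n" and z: "z \<in> (+) (0, L) ` K v" "z \<in> tail w"
  shows "z = (0, L) + node_pt h w"
proof -
  have "snd z = L" using high[OF v z(1)] tail_bounds[OF z(2)] by simp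
  then show ?thesis using tail_mem[OF z(2)] by (auto simp: prod_eq_iff)
qed

lemma extended_arc:
  assumes v: "v \<in> nodes n"
  shows "has_end_points (extended v) (foot v) (foot (m v))"
proof -
  note w = nodeD(1)[OF v]
  have 1: "has_end_points (tail v \<union> (+) (0, L) ` K v) (foot v) ((0, L) + node_pt h (m v))"
    using has_end_points_translation[OF arc[OF v]] shifted_tail[OF v v]
    by (intro prepend_tail[OF v]) blast+
  have "tail v \<inter> tail (m v) = {}"
  proof (rule ccontr)
    assume "tail v \<inter> tail (m v) \<noteq> {}"
    then obtain z where "z \<in> tail v" "z \<in> tail (m v)" by blast
    then show False using nodeD(2)[OF v] tail_mem[of z v] tail_mem[of z "m v"] by auto
  qed
  then have "has_end_points (tail (m v) \<union> (tail v \<union> (+) (0, L) ` K v)) (foot (m v)) (foot v)"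
    using has_end_points_sym[OF 1] shifted_tail[OF v w] by (intro prepend_tail[OF w]) blast+
  then show ?thesis
    unfolding extended_def by (metis Un_commute Un_left_commute has_end_points_sym)
qed

text \<open>
  The cup meets the extended arcs only in its end points, hence only the arcs that ended at \<open>Bot i\<close>
  and \<open>Bot (Suc i)\<close>.
\<close>

lemma cup_extended:
  assumes v: "v \<in> nodes n" and z: "z \<in> cup i L" "z \<in> extended v"
  shows "\<exists>j. (j = i \<or> j = Suc i) \<and> Bot j \<in> {v, m v} \<and> z = (real j, L)"
proof -
  note b = cup_bounds[OF z(1)]
  obtain j where j: "Bot j \<in> {v, m v}" "fst z = real j" "j = i \<or> j = Suc i \<longrightarrow> snd z = L"
    using extended_low[OF v z(2) b(4)] by blast
  then have "j = i \<or> j = Suc i" using b(1,2) real_between_Suc by metis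
  with j show ?thesis by (auto simp: prod_eq_iff)
qed

lemma cap_extended:
  assumes v: "v \<in> nodes n" shows "cap i 0 \<inter> extended v = {}"
proof (rule ccontr)
  assume "cap i 0 \<inter> extended v \<noteq> {}"
  then obtain z where z: "z \<in> cap i 0" "z \<in> extended v" by blast
  note b = cap_bounds[OF z(1)]
  then have "snd z < L" using L by simp
  then obtain j where j: "fst z = real j" "j = i \<or> j = Suc i \<longrightarrow> snd z = L"
    using extended_low[OF v z(2)] by fastforce
  then have "j = i \<or> j = Suc i" using b(1,2) real_between_Suc by metis
  with j \<open>snd z < L\<close> show False by auto
qed

lemma cap_cup: "cap i 0 \<inter> cup i L = {}"
  using cup_bounds(3) cap_bounds(4) L by fastforce

abbreviation left_end :: node where "left_end \<equiv> m (Bot i)"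
abbreviation right_end :: node where "right_end \<equiv> m (Bot (Suc i))"

text \<open>
  The arcs of the new diagram: the cap, the two extended arcs joined by the cup, and the remaining
  extended arcs. If \<open>left_end\<close> is \<open>Bot (Suc i)\<close>, the second case does not arise, and the closed curve
  formed with the cup goes to the remainder instead.
\<close>

definition hooked :: "node \<Rightarrow> (real \<times> real) set" where
  "hooked v =
     (if v = Bot i \<or> v = Bot (Suc i) then cap i 0
      else if v = left_end \<or> v = right_end then extended (Bot i) \<union> cup i L \<union> extended (Bot (Suc i))
      else extended v)"

definition hooked_rest :: "(real \<times> real) set" where
  "hooked_rest = (+) (0, L) ` R \<union>
     (if left_end = Bot (Suc i) then extended (Bot i) \<union> cup i L else {})"

lemma hook_nodes: "Bot i \<in> nodes n" "Bot (Suc i) \<in> nodes n"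
  using i by auto

lemma foot_hook: "foot (Bot i) = (real i, L)" "foot (Bot (Suc i)) = (real (Suc i), L)"
  by (auto simp: foot_def)

lemma foot_node_pt: "v \<noteq> Bot i \<Longrightarrow> v \<noteq> Bot (Suc i) \<Longrightarrow> foot v = node_pt (h + L) v"
  by (cases v) (auto simp: foot_def)

lemma hook_ends:
  "left_end = Bot (Suc i) \<longleftrightarrow> right_end = Bot i" "left_end \<noteq> right_end"
  "left_end \<noteq> Bot i" "right_end \<noteq> Bot (Suc i)"
  using hook_nodes nodeD matching_inj[OF matching] by (metis, fastforce, metis, metis)

lemma joined_arc:
  assumes "left_end \<noteq> Bot (Suc i)"
  shows "has_end_points (extended (Bot i) \<union> cup i L \<union> extended (Bot (Suc i)))
           (node_pt (h + L) left_end) (node_pt (h + L) right_end)"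
proof -
  have ne: "right_end \<noteq> Bot i" using hook_ends assms by blast
  \<comment> \<open>These are different arcs, for otherwise the cup would close a circle.\<close>
  have disj: "extended (Bot i) \<inter> extended (Bot (Suc i)) = {}"
    using extended_disjoint hook_nodes ne by fastforce
  have l: "has_end_points (extended (Bot i)) (node_pt (h + L) left_end) (real i, L)"
    using has_end_points_sym[OF extended_arc[OF hook_nodes(1)]] foot_hook foot_node_pt hook_ends assms
    by metis
  have r: "has_end_points (extended (Bot (Suc i))) (real (Suc i), L) (node_pt (h + L) right_end)"
    using extended_arc[OF hook_nodes(2)] foot_hook foot_node_pt hook_ends ne by metis
  have "extended (Bot i) \<inter> cup i L \<subseteq> {(real i, L)}"
    using cup_extended[OF hook_nodes(1)] assms by fastforce
  moreover have "cup i L \<inter> extended (Bot (Suc i)) \<subseteq> {(real (Suc i), L)}"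
    using cup_extended[OF hook_nodes(2)] ne by fastforce
  ultimately show ?thesis
    using disj by (intro has_end_points_join[OF has_end_points_join[OF l has_end_points_cup] r]) auto
qed

lemma hooked_arc:
  assumes v: "v \<in> nodes n"
  shows "has_end_points (hooked v) (node_pt (h + L) v) (node_pt (h + L) (hook i m v))"
proof -
  consider "v = Bot i" | "v = Bot (Suc i)"
    | "v \<noteq> Bot i" "v \<noteq> Bot (Suc i)" "v = left_end"
    | "v \<noteq> Bot i" "v \<noteq> Bot (Suc i)" "v = right_end"
    | "v \<noteq> Bot i" "v \<noteq> Bot (Suc i)" "v \<noteq> left_end" "v \<noteq> right_end" by blast
  then show ?thesis
  proof cases
    case 1
    then show ?thesis using has_end_points_cap by (simp add: hooked_def hook_def)
  next
    case 2
    then show ?thesis using has_end_points_sym[OF has_end_points_cap]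
      by (simp add: hooked_def hook_def)
  next
    case 3
    then show ?thesis using joined_arc by (simp add: hooked_def hook_def)
  next
    case 4
    then have "left_end \<noteq> Bot (Suc i)" using hook_ends by metis
    with 4 show ?thesis using has_end_points_sym[OF joined_arc] hook_ends
      by (simp add: hooked_def hook_def)
  next
    case 5
    then have "m v \<noteq> Bot i" "m v \<noteq> Bot (Suc i)" using nodeD(3)[OF v] by auto
    with 5 show ?thesis using extended_arc[OF v] foot_node_pt
      by (simp add: hooked_def hook_def)
  qed
qed

text \<open>
  The three kinds of arcs in the new diagram, with the partner of the node in each case; the
  properties of an arc system are checked kind by kind.
\<close>

lemma hooked_cases:
  assumes v: "v \<in> nodes n"
  obtains "v \<in> {Bot i, Bot (Suc i)}" "hooked v = cap i 0" "hook i m v \<in> {Bot i, Bot (Suc i)}"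
  | "v \<in> {left_end, right_end}" "left_end \<noteq> Bot (Suc i)" "hook i m v \<in> {left_end, right_end}"
    "{v, hook i m v} = {left_end, right_end}"
    "hooked v = extended (Bot i) \<union> cup i L \<union> extended (Bot (Suc i))"
  | "v \<notin> {Bot i, Bot (Suc i), left_end, right_end}" "hooked v = extended v" "hook i m v = m v"
  using hook_ends unfolding hooked_def hook_def by (smt (verit) insert_commute insert_iff singletonD)

lemma cup_disjoint_extended:
  assumes "v \<in> nodes n" "v \<notin> {Bot i, Bot (Suc i), left_end, right_end}"
  shows "extended v \<inter> cup i L = {}"
  using cup_extended[OF assms(1)] assms nodeD(3)[OF assms(1)] by fastforce

lemma other_extended:
  assumes "v \<in> nodes n" "v \<notin> {Bot i, Bot (Suc i), left_end, right_end}"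
  shows "extended v \<inter> (extended (Bot i) \<union> cup i L \<union> extended (Bot (Suc i))) = {}"
  using cup_disjoint_extended[OF assms] extended_disjoint[OF assms(1) hook_nodes(1)]
    extended_disjoint[OF assms(1) hook_nodes(2)] assms(2) by auto

lemma hooked_disjoint:
  assumes u: "u \<in> nodes n" and v: "v \<in> nodes n" and neq: "u \<noteq> v" "u \<noteq> hook i m v"
  shows "hooked u \<inter> hooked v = {}"
proof -
  have cap_joined: "cap i 0 \<inter> (extended (Bot i) \<union> cup i L \<union> extended (Bot (Suc i))) = {}"
    using cap_extended[OF hook_nodes(1)] cap_extended[OF hook_nodes(2)] cap_cup by blast
  show ?thesis
  proof (cases rule: hooked_cases[OF u])
    case u: 1
    show ?thesis
    proof (cases rule: hooked_cases[OF v])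
      case 1
      then show ?thesis using u neq by (auto simp: hook_def)
    next
      case 2
      then show ?thesis using u cap_joined by simp
    next
      case 3
      then show ?thesis using u cap_extended[OF v] by simp
    qed
  next
    case u: 2
    show ?thesis
    proof (cases rule: hooked_cases[OF v])
      case 1
      then show ?thesis using u cap_joined by auto
    next
      case 2
      then show ?thesis using u neq by blast
    next
      case 3
      then show ?thesis using u other_extended[OF v] by blast
    qed
  next
    case u: 3
    show ?thesis
    proof (cases rule: hooked_cases[OF v])
      case 1
      then show ?thesis using u cap_extended[OF \<open>u \<in> nodes n\<close>] by auto
    next
      case 2
      then show ?thesis using u other_extended[OF \<open>u \<in> nodes n\<close>] by simp
    next
      case 3
      then show ?thesis using u neq extended_disjoint[OF \<open>u \<in> nodes n\<close> v] by simp
    qed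
  qed
qed

lemma hooked_union:
  "\<Union> (hooked ` nodes n) \<union> hooked_rest =
     (\<Union>v\<in>nodes n. extended v) \<union> cup i L \<union> cap i 0 \<union> (+) (0, L) ` R"
proof -
  have ext: "extended v \<subseteq> \<Union> (hooked ` nodes n) \<union> hooked_rest" if v: "v \<in> nodes n" for v
  proof -
    consider "v \<in> {Bot i, Bot (Suc i), left_end, right_end}" "left_end = Bot (Suc i)"
      | "v \<in> {Bot i, Bot (Suc i), left_end, right_end}" "left_end \<noteq> Bot (Suc i)"
      | "v \<notin> {Bot i, Bot (Suc i), left_end, right_end}" by argo
    then show ?thesis
    proof cases
      case 1
      then have "extended (Bot (Suc i)) = extended (Bot i)" "right_end = Bot i"
        using extended_m[OF hook_nodes(1)] hook_ends(1) by simp_all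
      then have "extended v = extended (Bot i)" using 1 by auto
      then show ?thesis using 1 by (auto simp: hooked_rest_def)
    next
      case 2
      then have "extended v = extended (Bot i) \<or> extended v = extended (Bot (Suc i))"
        using extended_m[OF hook_nodes(1)] extended_m[OF hook_nodes(2)] by auto
      moreover have "hooked left_end = extended (Bot i) \<union> cup i L \<union> extended (Bot (Suc i))"
        using 2 hook_ends(3) by (simp add: hooked_def)
      ultimately have "extended v \<subseteq> hooked left_end" by auto
      then show ?thesis using nodeD(1)[OF hook_nodes(1)] by auto
    next
      case 3
      then have "hooked v = extended v" by (simp add: hooked_def)
      then show ?thesis using v by auto
    qed
  qed
  have cup: "cup i L \<subseteq> \<Union> (hooked ` nodes n) \<union> hooked_rest"
  proof (cases "left_end = Bot (Suc i)")
    case True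
    then show ?thesis by (auto simp: hooked_rest_def)
  next
    case False
    then have "cup i L \<subseteq> hooked left_end" using hook_ends by (auto simp: hooked_def)
    then show ?thesis using nodeD(1)[OF hook_nodes(1)] by auto
  qed
  have "hooked (Bot i) = cap i 0" by (simp add: hooked_def)
  then have cap: "cap i 0 \<subseteq> \<Union> (hooked ` nodes n) \<union> hooked_rest"
    using UN_upper[OF hook_nodes(1), of hooked] by simp blast
  have R: "(+) (0, L) ` R \<subseteq> \<Union> (hooked ` nodes n) \<union> hooked_rest"
    by (auto simp: hooked_rest_def)
  have ends: "extended (Bot i) \<subseteq> (\<Union>v\<in>nodes n. extended v)"
    "extended (Bot (Suc i)) \<subseteq> (\<Union>v\<in>nodes n. extended v)"
    using UN_upper[OF hook_nodes(1), of extended] UN_upper[OF hook_nodes(2), of extended] by simp_all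
  have hooked: "hooked v \<subseteq> (\<Union>v\<in>nodes n. extended v) \<union> cup i L \<union> cap i 0"
    if v: "v \<in> nodes n" for v
    using ends UN_upper[OF v, of extended] unfolding hooked_def by (simp split: if_split) blast
  have rest: "hooked_rest \<subseteq> (\<Union>v\<in>nodes n. extended v) \<union> cup i L \<union> (+) (0, L) ` R"
    unfolding hooked_rest_def using ends by (simp split: if_split) blast
  show ?thesis
  proof (rule equalityI)
    show "\<Union> (hooked ` nodes n) \<union> hooked_rest
        \<subseteq> (\<Union>v\<in>nodes n. extended v) \<union> cup i L \<union> cap i 0 \<union> (+) (0, L) ` R"
      using hooked rest by (intro Un_least UN_least) (blast dest: subsetD)+
  next
    show "(\<Union>v\<in>nodes n. extended v) \<union> cup i L \<union> cap i 0 \<union> (+) (0, L) ` R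
        \<subseteq> \<Union> (hooked ` nodes n) \<union> hooked_rest"
      using ext cup cap R by (intro Un_least UN_least) assumption+
  qed
qed

lemma hooked_same_arc:
  assumes "v \<in> nodes n"
  shows "hooked (hook i m v) = hooked v"
proof (rule hooked_cases[OF assms], goal_cases)
  case 1
  then show ?case by (auto simp: hooked_def)
next
  case 2
  then show ?case using hook_ends by (auto simp: hooked_def)
next
  case 3
  then have "m v \<notin> {Bot i, Bot (Suc i), left_end, right_end}"
    using nodeD(3) assms hook_nodes by (metis insert_iff singletonD)
  with 3 show ?case using extended_m[OF assms] by (auto simp: hooked_def)
qed

lemma extended_floor:
  assumes v: "v \<in> nodes n" and z: "z \<in> extended v"
  shows "0 \<le> snd z" "snd z = 0 \<Longrightarrow> \<exists>j\<in>{1..n}. z = (real j, 0)"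
proof -
  show "0 \<le> snd z"
  proof (cases "snd z \<le> L")
    case True
    then show ?thesis using extended_low[OF v z] by blast
  qed (use L in simp)
  assume "snd z = 0"
  moreover obtain j where "j \<in> {1..n}" "fst z = real j"
    using extended_low[OF v z] L calculation by auto
  ultimately show "\<exists>j\<in>{1..n}. z = (real j, 0)" by (auto simp: prod_eq_iff)
qed

lemma hooked_floor:
  assumes v: "v \<in> nodes n" and z: "z \<in> hooked v"
  shows "0 \<le> snd z" "snd z = 0 \<Longrightarrow> \<exists>j\<in>{1..n}. z = (real j, 0)"
proof -
  have "(\<exists>w\<in>nodes n. z \<in> extended w) \<or> z \<in> cup i L \<or> z \<in> cap i 0"
    using hook_nodes v z by (auto simp: hooked_def split: if_splits)
  moreover have "0 < snd z" if "z \<in> cup i L" using cup_bounds(3)[OF that] L by simp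
  moreover have "0 \<le> snd z" "snd z = 0 \<Longrightarrow> \<exists>j\<in>{1..n}. z = (real j, 0)" if "z \<in> cap i 0"
    using cap_bounds(3)[OF that] cap_floor[OF i that] by auto
  ultimately show "0 \<le> snd z" "snd z = 0 \<Longrightarrow> \<exists>j\<in>{1..n}. z = (real j, 0)"
    using extended_floor by (metis less_imp_le, metis less_irrefl)
qed

lemma hooked_rest_disjoint:
  assumes v: "v \<in> nodes n"
  shows "hooked v \<inter> hooked_rest = {}"
proof -
  have R: "L < snd z" if "z \<in> (+) (0, L) ` R" for z using that rest_above by auto
  have ext: "extended w \<inter> (+) (0, L) ` R = {}" if w: "w \<in> nodes n" for w
  proof -
    have "z \<in> (+) (0, L) ` K w" if "z \<in> extended w" "z \<in> (+) (0, L) ` R" for z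
      using extended_high[OF w that(1)] R[OF that(2)] by simp
    then show ?thesis using rest_disjoint[OF w] by fastforce
  qed
  have cup: "cup i L \<inter> (+) (0, L) ` R = {}" using cup_bounds(4) R by fastforce
  have cap: "cap i 0 \<inter> (+) (0, L) ` R = {}" using cap_bounds(4) R L by fastforce
  have R_disj: "hooked v \<inter> (+) (0, L) ` R = {}"
    using ext[OF v] ext[OF hook_nodes(1)] ext[OF hook_nodes(2)] cup cap
    by (cases rule: hooked_cases[OF v]) (simp_all add: Int_Un_distrib2)
  have loop_disj: "hooked v \<inter> (extended (Bot i) \<union> cup i L) = {}" if "left_end = Bot (Suc i)"
  proof (cases rule: hooked_cases[OF v])
    case 1
    then show ?thesis using cap_extended[OF hook_nodes(1)] cap_cup by (simp add: Int_Un_distrib)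
  next
    case 2
    then show ?thesis using that by simp
  next
    case 3
    then show ?thesis using other_extended[OF v] by (simp add: Int_Un_distrib)
  qed
  show ?thesis using R_disj loop_disj by (simp add: hooked_rest_def Int_Un_distrib)
qed

lemma hooked_rest_compact: "compact hooked_rest"
  using compact_translation[OF rest_compact, of "(0, L)"]
    has_end_points_compact[OF extended_arc[OF hook_nodes(1)]]
    has_end_points_compact[OF has_end_points_cup[of i L]]
  by (auto simp: hooked_rest_def intro!: compact_Un)

lemma hooked_rest_above:
  assumes "z \<in> hooked_rest" shows "0 < snd z"
proof -
  consider "z \<in> (+) (0, L) ` R" | "z \<in> cup i L" | "left_end = Bot (Suc i)" "z \<in> extended (Bot i)"
    using assms by (auto simp: hooked_rest_def split: if_splits)
  then show ?thesis
  proof cases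
    case 1
    then show ?thesis using rest_above L by fastforce
  next
    case 2
    then show ?thesis using cup_bounds(3)[OF 2] L by simp
  next
    case 3
    then have "z \<in> (+) (0, L) ` K (Bot i)" by (auto simp: extended_def tail_def)
    then show ?thesis using high[OF hook_nodes(1)] L by fastforce
  qed
qed

lemma arc_system_hooked: "arc_system n (h + L) (hook i m) hooked hooked_rest"
  by (rule arc_system.intro)
    (use height_pos L in simp, rule matching_hook[OF matching i], erule hooked_arc,
      erule hooked_same_arc, rule hooked_disjoint, assumption+, rule hooked_floor(1), assumption+,
      rule hooked_floor(2), assumption+, rule hooked_rest_compact, erule hooked_rest_disjoint,
      erule hooked_rest_above)

end

section \<open>Diapsidal diagrams\<close>

lemma diapsis_height_ge: "5 \<le> diapsis_height n"
  by (simp add: diapsis_height_def)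

lemma pts_diapsidal_diagram:
  "pts (diapsidal_diagram n i) =
     cup i (diapsis_height n) \<union> cap i 0 \<union> real ` ({1..n} - {i, Suc i}) \<times> {0..diapsis_height n}"
  by (simp add: diapsidal_diagram_def cup_def cap_def Let_def)

lemma height_diapsidal_diagram [simp]: "height (diapsidal_diagram n i) = diapsis_height n"
  by (simp add: diapsidal_diagram_def Let_def)

lemma pts_compose: "pts (compose D E) = (+) (0, height D) ` pts E \<union> pts D"
proof -
  have "(\<lambda>(x :: real, y). (x, y + height D)) = (+) (0, height D)" by (auto simp: fun_eq_iff)
  then show ?thesis by (simp add: compose_def)
qed

lemma height_compose [simp]: "height (compose D E) = height E + height D"
  by (simp add: compose_def)

lemma realizes_compose_diapsidal:
  assumes "realizes n D m" "1 \<le> i" "i < n"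
  shows "realizes n (compose (diapsidal_diagram n i) D) (hook i m)"
proof -
  obtain K R where "arc_system n (height D) m K R" and D: "pts D = \<Union> (K ` nodes n) \<union> R"
    using assms(1) unfolding realizes_def by blast
  then interpret arc_system n "height D" m K R by simp
  interpret hooked_arc_system n "height D" m K R i "diapsis_height n"
    using assms diapsis_height_ge[of n] by unfold_locales auto
  let ?L = "diapsis_height n"
  have "(\<Union>v\<in>nodes n. tail v \<union> tail (m v)) = (\<Union>v\<in>nodes n. tail v)"
    using nodeD(1) by blast
  also have "\<dots> = real ` ({1..n} - {i, Suc i}) \<times> {0..?L}"
    by (auto simp: nodes_def tail_def split: if_splits)
  finally have "(\<Union>v\<in>nodes n. extended v) =
      (+) (0, ?L) ` \<Union> (K ` nodes n) \<union> real ` ({1..n} - {i, Suc i}) \<times> {0..?L}"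
    unfolding extended_def by blast
  then have "pts (compose (diapsidal_diagram n i) D) = \<Union> (hooked ` nodes n) \<union> hooked_rest"
    unfolding hooked_union pts_compose pts_diapsidal_diagram D by (simp add: image_Un) blast
  then show ?thesis
    unfolding realizes_def using arc_system_hooked by (metis height_compose height_diapsidal_diagram)
qed

text \<open>
  A single diapsis is the base of the construction. It does not arise from an arc system by placing
  a diapsis below it, because nothing of positive height lies above it; its arcs are therefore listed
  directly.
\<close>

lemma realizes_diapsidal:
  assumes i: "1 \<le> i" "i < n"
  shows "realizes n (diapsidal_diagram n i) (hook i straight)"
proof -
  let ?L = "diapsis_height n"
  define K where "K v =
     (if v = Bot i \<or> v = Bot (Suc i) then cap i 0
      else if v = Top i \<or> v = Top (Suc i) then cup i ?L
      else {real (pos v)} \<times> {0..?L})" for v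
  have L: "1 < ?L" using diapsis_height_ge[of n] by simp
  \<comment> \<open>The subtraction of \<open>{v}\<close> records that a semicircle belongs to exactly two nodes.\<close>
  have kinds: "v \<in> {Bot i, Bot (Suc i)} \<and> K v = cap i 0 \<and> hook i straight v \<in> {Bot i, Bot (Suc i)} - {v}
      \<or> v \<in> {Top i, Top (Suc i)} \<and> K v = cup i ?L \<and> hook i straight v \<in> {Top i, Top (Suc i)} - {v}
      \<or> pos v \<noteq> i \<and> pos v \<noteq> Suc i \<and> K v = {real (pos v)} \<times> {0..?L} \<and> hook i straight v = straight v" for v
    by (cases v) (auto simp: K_def hook_def)
  have pos: "pos v \<in> {1..n}" if "v \<in> nodes n" for v
    using that by (auto simp: nodes_def)
  have bounds: "0 \<le> snd z" if "z \<in> K v" for v z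
    using kinds[of v] that cap_bounds(3)[of z i 0] cup_bounds(3)[of z i ?L] L by auto
  have "arc_system n ?L (hook i straight) K {}"
  proof (rule arc_system.intro)
    show "0 < ?L" using L by simp
    show "matching n (hook i straight)" using matching_hook[OF matching_straight i] .
  next
    fix v assume "v \<in> nodes n"
    show "has_end_points (K v) (node_pt ?L v) (node_pt ?L (hook i straight v))"
      using has_end_points_cap[of i 0] has_end_points_cup[of i ?L]
        has_end_points_segment[of 0 ?L "real (pos v)"] L
        has_end_points_sym[OF has_end_points_cap[of i 0]] has_end_points_sym[OF has_end_points_cup[of i ?L]]
        has_end_points_sym[OF has_end_points_segment[of 0 ?L "real (pos v)"]]
      by (cases v) (auto simp: K_def hook_def)
    show "K (hook i straight v) = K v"
      by (cases v) (auto simp: K_def hook_def)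
    show "K v \<inter> {} = {}" by simp
  next
    fix u v assume uv: "u \<noteq> v" "u \<noteq> hook i straight v"
    have x: "real i \<le> fst z \<and> fst z \<le> real (Suc i)" if "z \<in> cap i 0 \<or> z \<in> cup i ?L" for z
      using that cap_bounds(1,2) cup_bounds(1,2) by blast
    have "cap i 0 \<inter> cup i ?L = {}"
      using cap_bounds(4)[of _ i 0] cup_bounds(3)[of _ i ?L] diapsis_height_ge[of n] by fastforce
    moreover have "({real p} \<times> {0..?L}) \<inter> cap i 0 = {}" "({real p} \<times> {0..?L}) \<inter> cup i ?L = {}"
      if "p \<noteq> i" "p \<noteq> Suc i" for p
      using that x real_between_Suc by fastforce+
    moreover have "pos u \<noteq> pos v" if "hook i straight v = straight v"
      using uv that by (cases u; cases v) auto
    ultimately show "K u \<inter> K v = {}"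
      using kinds[of u] kinds[of v] uv by (elim disjE) (auto simp: Int_commute)
  next
    fix v z assume v: "v \<in> nodes n" and z: "z \<in> K v"
    show "0 \<le> snd z" using bounds[OF z] .
    assume "snd z = 0"
    then show "\<exists>j\<in>{1..n}. z = (real j, 0)"
      using kinds[of v] z cap_floor[OF i, of z] cup_bounds(3)[of z i ?L] L pos[OF v]
      by auto
  qed auto
  moreover have "pts (diapsidal_diagram n i) = \<Union> (K ` nodes n) \<union> {}"
  proof (rule equalityI)
    have "real ` ({1..n} - {i, Suc i}) \<times> {0..?L} \<subseteq> \<Union> (K ` nodes n)"
    proof
      fix z assume "z \<in> real ` ({1..n} - {i, Suc i}) \<times> {0..?L}"
      then obtain j where "j \<in> {1..n} - {i, Suc i}" "z \<in> {real j} \<times> {0..?L}" by blast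
      then have "z \<in> K (Top j)" "Top j \<in> nodes n" by (auto simp: K_def)
      then show "z \<in> \<Union> (K ` nodes n)" by blast
    qed
    moreover have "cup i ?L \<subseteq> \<Union> (K ` nodes n)"
      using UN_upper[of "Top i" "nodes n" K] i by (simp add: K_def)
    moreover have "cap i 0 \<subseteq> \<Union> (K ` nodes n)"
      using UN_upper[of "Bot i" "nodes n" K] i by (simp add: K_def)
    ultimately show "pts (diapsidal_diagram n i) \<subseteq> \<Union> (K ` nodes n) \<union> {}"
      unfolding pts_diapsidal_diagram by simp
    have "K v \<subseteq> pts (diapsidal_diagram n i)" if "v \<in> nodes n" for v
      using kinds[of v] pos[OF that] unfolding pts_diapsidal_diagram by (elim disjE) auto
    then show "\<Union> (K ` nodes n) \<union> {} \<subseteq> pts (diapsidal_diagram n i)" by blast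
  qed
  ultimately show ?thesis unfolding realizes_def by auto
qed

section \<open>Terms as words\<close>

text \<open>
  The empty picture of height \<open>0\<close> is not an \<open>n\<close>-diagram, but it is the neutral element of \<open>compose\<close>,
  so that stacking becomes a monoid homomorphism on words.
\<close>

definition stack :: "diagram list \<Rightarrow> diagram" where
  "stack Ds = foldr compose Ds \<lparr>pts = {}, height = 0\<rparr>"

lemma compose_assoc: "compose (compose D E) F = compose D (compose E F)"
  by (rule diagram.equality)
    (auto simp: pts_compose image_Un image_image add.commute add.left_commute)

lemma compose_empty [simp]:
  "compose \<lparr>pts = {}, height = 0\<rparr> D = D" "compose D \<lparr>pts = {}, height = 0\<rparr> = D"
  by (auto intro!: diagram.equality simp: pts_compose zero_prod_def[symmetric])

lemma stack_simps [simp]: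
  "stack [] = \<lparr>pts = {}, height = 0\<rparr>" "stack (D # Ds) = compose D (stack Ds)"
  by (simp_all add: stack_def)

lemma stack_append [simp]: "stack (Ds @ Es) = compose (stack Ds) (stack Es)"
  by (induction Ds) (auto simp: compose_assoc)

lemma delta_lprod:
  assumes "ts \<noteq> []"
  shows "delta n (lprod ts) = stack (map (delta n) ts)"
proof -
  have "delta n (foldl Mult t us) = compose (delta n t) (stack (map (delta n) us))" for t us
    by (induction us arbitrary: t) (auto simp: compose_assoc)
  then show ?thesis using assms by (cases ts) auto
qed

lemma delta_block:
  assumes "a \<le> b"
  shows "delta n (block b a) = stack (map (diapsidal_diagram n) (rev [a..<Suc b]))"
proof -
  have "map Hgen (rev [a..<Suc b]) \<noteq> []" using assms by simp
  from delta_lprod[OF this] show ?thesis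
    unfolding block_def map_map by (simp add: comp_def)
qed

text \<open>
  The word of the Jones normal form given by a list of pairs \<open>(a, b)\<close>, one for each block
  \<open>h\<^bsup>[b,a]\<^esup>\<close>.
\<close>

definition jones_word :: "(nat \<times> nat) list \<Rightarrow> nat list" where
  "jones_word ps = concat (map (\<lambda>(a, b). rev [a..<Suc b]) ps)"

lemma delta_jones_word:
  assumes "ps \<noteq> []" "\<forall>(a, b)\<in>set ps. a \<le> b"
  shows "delta n (lprod (map (\<lambda>(a, b). block b a) ps)) = stack (map (diapsidal_diagram n) (jones_word ps))"
proof -
  have "stack (map (delta n) (map (\<lambda>(a, b). block b a) ps)) = stack (map (diapsidal_diagram n) (jones_word ps))"
    using assms(2) by (induction ps) (auto simp: jones_word_def delta_block simp del: upt_Suc)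
  then show ?thesis using delta_lprod assms(1) by simp
qed

lemma realizes_stack:
  assumes "ws \<noteq> []" "set ws \<subseteq> {1..<n}"
  shows "realizes n (stack (map (diapsidal_diagram n) ws)) (foldr hook ws straight)"
  using assms
proof (induction ws rule: list_nonempty_induct)
  case (single i)
  then show ?case using realizes_diapsidal by simp
next
  case (cons i ws)
  then show ?case using realizes_compose_diapsidal by simp
qed

section \<open>Slopes of the Jones normal form\<close>

text \<open>
  If the strand at \<open>p\<close> is straight, then \<open>Bot p\<close> is not the partner of another bottom point, so a
  diapsis elsewhere leaves the strand alone.
\<close>

lemma hook_straight_strand:
  assumes "m (Bot p) = Top p" "p \<noteq> i" "p \<noteq> Suc i" "matching n m" "1 \<le> i" "i < n" "p \<in> {1..n}"
  shows "hook i m (Bot p) = Top p"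
  using assms matchingD(3)[of n m "Bot i"] matchingD(3)[of n m "Bot (Suc i)"]
  by (auto simp: hook_def)

text \<open>
  Let \<open>w\<close> be the partner of \<open>Bot (Suc i)\<close>, which lies at position \<open>i + 1\<close> or further to the right.
  The cup joins \<open>Top i\<close> to \<open>w\<close>, so \<open>Top i\<close> becomes a slope point, and the cap makes \<open>Bot (Suc i)\<close>
  one. The status of \<open>w\<close> does not change, because neither its old nor its new partner lies to its
  right: if \<open>w\<close> is a top point, it is no slope point before and after; if it is a bottom point, both
  partners lie strictly to its left and it is one before and after.
\<close>

lemma slopes_hook_open:
  assumes m: "matching n m" and i: "1 \<le> i" "i < n" and str: "m (Bot i) = Top i"
    and next_flat: "Suc i \<notin> bottom_slopes n m"
  shows "top_slopes n (hook i m) = insert i (top_slopes n m)"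
    and "bottom_slopes n (hook i m) = insert (Suc i) (bottom_slopes n m)"
proof -
  have inn: "Bot i \<in> nodes n" "Bot (Suc i) \<in> nodes n" using i by auto
  define w where "w = m (Bot (Suc i))"
  have mw: "m w = Bot (Suc i)" "w \<noteq> Bot (Suc i)" "w \<noteq> Bot i" "w \<noteq> Top i" "m (Top i) = Bot i"
    using matchingD[OF m inn(1)] matchingD[OF m inn(2)] str unfolding w_def by auto
  have pw: "Suc i \<le> pos w"
    using next_flat i unfolding bottom_slopes_def w_def by auto
  have h: "hook i m v = (if v = Bot i then Bot (Suc i) else if v = Bot (Suc i) then Bot i
      else if v = Top i then w else if v = w then Top i else m v)" for v
    unfolding hook_def str w_def[symmetric] by simp
  show "top_slopes n (hook i m) = insert i (top_slopes n m)"
  proof (rule set_eqI)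
    fix p
    show "p \<in> top_slopes n (hook i m) \<longleftrightarrow> p \<in> insert i (top_slopes n m)"
      using mw pw i unfolding top_slopes_def h by (cases "Top p = w") auto
  qed
  show "bottom_slopes n (hook i m) = insert (Suc i) (bottom_slopes n m)"
  proof (rule set_eqI)
    fix p
    have "Suc i < p" if "Bot p = w"
      using pw mw(2) that by (cases "p = Suc i") auto
    then show "p \<in> bottom_slopes n (hook i m) \<longleftrightarrow> p \<in> insert (Suc i) (bottom_slopes n m)"
      using mw pw i str unfolding bottom_slopes_def h by (cases "Bot p = w") auto
  qed
qed

text \<open>
  The diapsis with index \<open>i + 1\<close> is placed below a cap that joins \<open>Bot i\<close> and \<open>Bot (i + 1)\<close>. The strand
  that came down to \<open>Bot (i + 2)\<close> from a node \<open>w\<close>, at position \<open>i + 2\<close> or further to the right, is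
  led back to \<open>Bot i\<close>. As above this does not change the status of \<open>w\<close>, and the only change in the
  slopes comes from the cap, which moves one step to the right.
\<close>

lemma slopes_hook_slide:
  assumes m: "matching n m" and i: "1 \<le> i" "Suc i < n" and cap: "m (Bot i) = Bot (Suc i)"
    and next_flat: "Suc (Suc i) \<notin> bottom_slopes n m"
  shows "top_slopes n (hook (Suc i) m) = top_slopes n m"
    and "bottom_slopes n (hook (Suc i) m) = insert (Suc (Suc i)) (bottom_slopes n m - {Suc i})"
proof -
  let ?i = "Suc i"
  have inn: "Bot i \<in> nodes n" "Bot ?i \<in> nodes n" "Bot (Suc ?i) \<in> nodes n" using i by auto
  have cap': "m (Bot ?i) = Bot i" using matchingD(3)[OF m inn(1)] cap by simp
  define w where "w = m (Bot (Suc ?i))"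
  have mw: "m w = Bot (Suc ?i)" "w \<noteq> Bot (Suc ?i)" "w \<noteq> Bot ?i" "w \<noteq> Bot i"
    using matchingD[OF m inn(1)] matchingD[OF m inn(2)] matchingD[OF m inn(3)] cap cap'
    unfolding w_def by auto
  have pw: "Suc ?i \<le> pos w"
    using next_flat i unfolding bottom_slopes_def w_def by auto
  have h: "hook ?i m v = (if v = Bot ?i then Bot (Suc ?i) else if v = Bot (Suc ?i) then Bot ?i
      else if v = Bot i then w else if v = w then Bot i else m v)" for v
    unfolding hook_def cap' w_def[symmetric] by simp
  show "top_slopes n (hook ?i m) = top_slopes n m"
  proof (rule set_eqI)
    fix p
    show "p \<in> top_slopes n (hook ?i m) \<longleftrightarrow> p \<in> top_slopes n m"
      using mw pw i unfolding top_slopes_def h by (cases "Top p = w") auto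
  qed
  show "bottom_slopes n (hook ?i m) = insert (Suc ?i) (bottom_slopes n m - {?i})"
  proof (rule set_eqI)
    fix p
    have "Suc ?i < p" if "Bot p = w"
      using pw mw(2) that by (cases "p = Suc ?i") auto
    then show "p \<in> bottom_slopes n (hook ?i m) \<longleftrightarrow> p \<in> insert (Suc ?i) (bottom_slopes n m - {?i})"
      using mw pw i cap unfolding bottom_slopes_def h by (cases "Bot p = w") auto
  qed
qed

text \<open>
  The letters of a block are added from \<open>h\<^sup>a\<close> down to \<open>h\<^sup>b\<close>: the first one opens a new pair of slope
  points, the others slide the bottom one from \<open>a + 1\<close> to \<open>b + 1\<close>.
\<close>

lemma slopes_hook_block:
  assumes m: "matching n m" and a: "1 \<le> a" "a \<le> b" "b < n" and str: "m (Bot a) = Top a"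
    and flat: "\<And>q. \<lbrakk>a < q; q \<le> Suc b\<rbrakk> \<Longrightarrow> q \<notin> bottom_slopes n m"
  defines "m' \<equiv> foldr hook (rev [a..<Suc b]) m"
  shows "matching n m'"
    and "top_slopes n m' = insert a (top_slopes n m)"
    and "bottom_slopes n m' = insert (Suc b) (bottom_slopes n m)"
    and "\<And>p. \<lbrakk>1 \<le> p; p < a; m (Bot p) = Top p\<rbrakk> \<Longrightarrow> m' (Bot p) = Top p"
proof -
  have "matching n m' \<and> m' (Bot b) = Bot (Suc b) \<and> top_slopes n m' = insert a (top_slopes n m)
      \<and> bottom_slopes n m' = insert (Suc b) (bottom_slopes n m)
      \<and> (\<forall>p. 1 \<le> p \<longrightarrow> p < a \<longrightarrow> m (Bot p) = Top p \<longrightarrow> m' (Bot p) = Top p)"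
    using a(2,3) flat unfolding m'_def
  proof (induction b rule: dec_induct)
    case base
    have "Suc a \<notin> bottom_slopes n m" using base by simp
    then show ?case
      using matching_hook[OF m] slopes_hook_open[OF m _ _ str] hook_straight_strand[OF _ _ _ m]
        base a(1) by (auto simp: hook_def[of a m "Bot a"])
  next
    case (step b)
    define k where "k = foldr hook (rev [a..<Suc b]) m"
    have IH: "matching n k" "k (Bot b) = Bot (Suc b)" "top_slopes n k = insert a (top_slopes n m)"
        "bottom_slopes n k = insert (Suc b) (bottom_slopes n m)"
        "\<And>p. 1 \<le> p \<Longrightarrow> p < a \<Longrightarrow> m (Bot p) = Top p \<Longrightarrow> k (Bot p) = Top p"
      using step.IH step.prems step.hyps unfolding k_def by auto
    have b: "1 \<le> b" "Suc b < n" using step a(1) by auto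
    have flat: "Suc b \<notin> bottom_slopes n m" "Suc (Suc b) \<notin> bottom_slopes n m"
      using step.prems(2) step.hyps by auto
    have eq: "foldr hook (rev [a..<Suc (Suc b)]) m = hook (Suc b) k"
      using step.hyps unfolding k_def by simp
    have "Suc (Suc b) \<notin> bottom_slopes n k" using flat IH(4) by simp
    note slide = slopes_hook_slide[OF IH(1) b IH(2) this]
    have "hook (Suc b) k (Bot p) = Top p" if "1 \<le> p" "p < a" "m (Bot p) = Top p" for p
      using hook_straight_strand[OF IH(5)[OF that] _ _ IH(1)] that step.hyps b by auto
    then show ?case
      unfolding eq using slide IH flat matching_hook[OF IH(1)] b
      by (auto simp: hook_def[of "Suc b" k "Bot (Suc b)"])
  qed
  then show "matching n m'" "top_slopes n m' = insert a (top_slopes n m)"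
    "bottom_slopes n m' = insert (Suc b) (bottom_slopes n m)"
    "\<And>p. \<lbrakk>1 \<le> p; p < a; m (Bot p) = Top p\<rbrakk> \<Longrightarrow> m' (Bot p) = Top p"
    by blast+
qed

text \<open>
  Blocks further down have smaller \<open>a\<close> and \<open>b\<close>. The induction therefore also carries that the strands to
  the left of all \<open>a\<close> processed so far are straight; that the bottom points up to \<open>b + 1\<close> of the next
  block are no slope points follows from the description of the slopes.
\<close>

lemma slopes_jones_word:
  assumes "sorted_wrt (\<lambda>(a, b) (a', b'). a < a' \<and> b < b') ps"
    and "\<forall>(a, b)\<in>set ps. 1 \<le> a \<and> a \<le> b \<and> b < n"
  defines "m \<equiv> foldr hook (jones_word ps) straight"
  shows "matching n m" "top_slopes n m = fst ` set ps" "bottom_slopes n m = Suc ` snd ` set ps"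
proof -
  have "matching n m \<and> top_slopes n m = fst ` set ps \<and> bottom_slopes n m = Suc ` snd ` set ps
     \<and> (\<forall>p. 1 \<le> p \<longrightarrow> (\<forall>a\<in>fst ` set ps. p < a) \<longrightarrow> m (Bot p) = Top p)"
    using assms(1,2) unfolding m_def
  proof (induction ps)
    case Nil
    then show ?case
      using matching_straight by (auto simp: jones_word_def top_slopes_def bottom_slopes_def)
  next
    case (Cons ab ps)
    obtain a b where ab: "ab = (a, b)" by fastforce
    define k where "k = foldr hook (jones_word ps) straight"
    have IH: "matching n k" "top_slopes n k = fst ` set ps" "bottom_slopes n k = Suc ` snd ` set ps"
        "\<And>p. 1 \<le> p \<Longrightarrow> \<forall>a\<in>fst ` set ps. p < a \<Longrightarrow> k (Bot p) = Top p"
      using Cons unfolding k_def by auto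
    have bound: "1 \<le> a" "a \<le> b" "b < n" using Cons.prems ab by auto
    have less: "a < a'" "b < b'" if "(a', b') \<in> set ps" for a' b'
      using Cons.prems(1) that ab by auto
    have str: "k (Bot p) = Top p" if "1 \<le> p" "p \<le> a" for p
      using IH(4) that less by fastforce
    have flat: "q \<notin> bottom_slopes n k" if "q \<le> Suc b" for q
      using that less unfolding IH(3) by fastforce
    have eq: "foldr hook (jones_word (ab # ps)) straight = foldr hook (rev [a..<Suc b]) k"
      by (simp add: jones_word_def ab k_def del: upt_Suc)
    note blk = slopes_hook_block[OF IH(1) bound str[OF bound(1)] flat]
    show ?case
      unfolding eq using blk IH str ab by (auto simp del: upt_Suc)
  qed
  then show "matching n m" "top_slopes n m = fst ` set ps" "bottom_slopes n m = Suc ` snd ` set ps"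
    by blast+
qed

theorem lemma4:
  fixes n k :: nat and a b :: "nat \<Rightarrow> nat" and t :: trm
  assumes "2 \<le> n" and "1 \<le> k"
    and "\<And>m. m \<in> {1..k} \<Longrightarrow> 1 \<le> a m \<and> a m \<le> b m \<and> b m \<le> n - 1"
    and "strict_mono_on {1..k} a" and "strict_mono_on {1..k} b"
    and "t = lprod (map (\<lambda>m. block (b m) (a m)) [1..<Suc k])"
  shows "T_seq n (delta n t) = map a [1..<Suc k] \<and> B_seq n (delta n t) = map b [1..<Suc k]"
proof -
  define ps where "ps = map (\<lambda>m. (a m, b m)) [1..<Suc k]"
  define m where "m = foldr hook (jones_word ps) straight"
  have bounds: "\<forall>(a, b)\<in>set ps. 1 \<le> a \<and> a \<le> b \<and> b < n"
    using assms(1,3) unfolding ps_def by fastforce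
  have ne: "ps \<noteq> []" using assms(2) by (simp add: ps_def)
  have mono: "sorted_wrt (<) (map f [1..<Suc k])" if "strict_mono_on {1..k} f" for f :: "nat \<Rightarrow> nat"
    unfolding sorted_wrt_map using that
    by (intro sorted_wrt_mono_rel[OF _ sorted_wrt_upt]) (auto simp: strict_mono_on_def simp del: upt_Suc)
  have "sorted_wrt (\<lambda>(a, b) (a', b'). a < a' \<and> b < b') ps"
    unfolding ps_def sorted_wrt_map using assms(4,5)
    by (intro sorted_wrt_mono_rel[OF _ sorted_wrt_upt]) (auto simp: strict_mono_on_def simp del: upt_Suc)
  note slopes = slopes_jones_word[OF this bounds, folded m_def]
  have "t = lprod (map (\<lambda>(a, b). block b a) ps)"
    by (simp add: assms(6) ps_def comp_def)
  then have "delta n t = stack (map (diapsidal_diagram n) (jones_word ps))"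
    using delta_jones_word[OF ne] bounds by fastforce
  moreover have "jones_word ps \<noteq> []" "set (jones_word ps) \<subseteq> {1..<n}"
    using ne bounds by (cases ps; fastforce simp: jones_word_def)+
  ultimately have real: "realizes n (delta n t) m"
    using realizes_stack unfolding m_def by simp
  have "fst ` set ps = set (map a [1..<Suc k])" "{q. Suc q \<in> Suc ` snd ` set ps} = set (map b [1..<Suc k])"
    by (auto simp: ps_def image_image)
  then show ?thesis
    using realizes_T_seq[OF real] realizes_B_seq[OF real] mono[OF assms(4)] mono[OF assms(5)]
    by (simp only: slopes sorted_list_of_set.idem_if_sorted_distinct strict_sorted_iff)
qed

end
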